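(* Let $a\in\mathbb{R}$ and $L>0$. Consider the problem $$u''' + a u' - u^2 u' = 0 \ \text{ on } [0,L], \qquad u(0)=u(L)=u'(L)=0. \qquad ( * )$$ If $aL^2>4\pi^2$, then there exists a nontrivial solution $u$ of $( * )$ with fundamental period $L$, and it is unique up to sign (i.e. the nontrivial solutions of $( * )$ with fundamental period $L$ are exactly $u$ and $-u$). If $aL^2\leq 4\pi^2$, then there is no nontrivial solution of $( * )$ with fundamental period $L$.
   Context: Solutions are real-valued functions $u\in C^3[0,L]$; nontrivial means not identically zero. Any solution of $( * )$ is infinitely smooth and periodic with period $L$, i.e. it extends to an $L$-periodic $C^\infty$ function on $\mathbb{R}$. The fundamental period of a nontrivial periodic function is its minimal positive period; the fundamental period of a solution on $[0,L]$ means that of its $L$-periodic extension to $\mathbb{R}$. *)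

theory Defs
  imports "HOL-Analysis.Analysis"
begin

text \<open>
  Membership of \<open>u\<close> in $C^3[0,L]$, with \<open>u1\<close>, \<open>u2\<close>, \<open>u3\<close> its first three derivatives on the
  interval. Derivatives at the endpoints are one-sided, and for \<open>L > 0\<close> they are unique.
\<close>

definition C3_on_with ::
  "real \<Rightarrow> (real \<Rightarrow> real) \<Rightarrow> (real \<Rightarrow> real) \<Rightarrow> (real \<Rightarrow> real) \<Rightarrow> (real \<Rightarrow> real) \<Rightarrow> bool" where
  "C3_on_with L u u1 u2 u3 \<longleftrightarrow>
     (\<forall>x\<in>{0..L}. (u has_real_derivative u1 x) (at x within {0..L})) \<and>
     (\<forall>x\<in>{0..L}. (u1 has_real_derivative u2 x) (at x within {0..L})) \<and>
     (\<forall>x\<in>{0..L}. (u2 has_real_derivative u3 x) (at x within {0..L})) \<and>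
     continuous_on {0..L} u3"

definition is_solution :: "real \<Rightarrow> real \<Rightarrow> (real \<Rightarrow> real) \<Rightarrow> bool" where
  "is_solution a L u \<longleftrightarrow>
     (\<exists>u1 u2 u3. C3_on_with L u u1 u2 u3 \<and>
        (\<forall>x\<in>{0..L}. u3 x + a * u1 x - (u x)\<^sup>2 * u1 x = 0) \<and>
        u 0 = 0 \<and> u L = 0 \<and> u1 L = 0)"

definition nontrivial_on :: "real \<Rightarrow> (real \<Rightarrow> real) \<Rightarrow> bool" where
  "nontrivial_on L u \<longleftrightarrow> (\<exists>x\<in>{0..L}. u x \<noteq> 0)"

text \<open>
  The \<open>L\<close>-periodic function on the real line that agrees with \<open>u\<close> on $[0,L)$; when
  \<open>u L = u 0\<close>, as for every solution, it agrees with \<open>u\<close> on all of $[0,L]$.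
\<close>

definition periodic_extension :: "real \<Rightarrow> (real \<Rightarrow> real) \<Rightarrow> real \<Rightarrow> real" where
  "periodic_extension L u x = u (x - L * of_int \<lfloor>x / L\<rfloor>)"

definition is_period :: "(real \<Rightarrow> real) \<Rightarrow> real \<Rightarrow> bool" where
  "is_period f T \<longleftrightarrow> T > 0 \<and> (\<forall>x. f (x + T) = f x)"

definition is_fundamental_period :: "(real \<Rightarrow> real) \<Rightarrow> real \<Rightarrow> bool" where
  "is_fundamental_period f T \<longleftrightarrow> is_period f T \<and> (\<forall>S. is_period f S \<longrightarrow> T \<le> S)"

definition is_nontrivial_solution_with_fundamental_period_L ::
  "real \<Rightarrow> real \<Rightarrow> (real \<Rightarrow> real) \<Rightarrow> bool" where
  "is_nontrivial_solution_with_fundamental_period_L a L u \<longleftrightarrow>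
     is_solution a L u \<and> nontrivial_on L u \<and>
     is_fundamental_period (periodic_extension L u) L"

end

theory Submission
  imports Defs
begin

text \<open>
  One integration turns the equation into $u'' = c - a u + u^3/3$. A second one, with the constant
  fixed by $u(L) = u'(L) = 0$, gives $u'^2 = u \, (2c - a u + u^3/6)$; this forces $u'(0) = 0$ as
  well. A nontrivial solution therefore solves an autonomous second-order Cauchy problem with zero
  data at $0$, and only $c$ has to be determined. Up to the sign of $u$, the maximum $r$ of $u$ is
  positive, and $u' = 0$ there, so that $2c = a r - r^3/6$. Since $u$ takes every value between
  $0$ and $r$, the right-hand side of the second equation is nonnegative there, whence
  $r^2 \le 2a$; equality would make the constant $r$ a second solution through the maximum.
  So $0 < r$ and $r^2 < 2a$, in particular $a > 0$ (\<open>positive_solution_profile\<close>).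

  For such $r$ the substitution $u = r \sin^2\Theta$ removes the square-root
  singularities at the two turning points: it leads to $\Theta' = w_r(\Theta)$ with
  $w_r(\phi) = \frac12 \sqrt{a - \frac{r^2}{6}(1 + \sin^2\phi + \sin^4\phi)}$, a smooth positive
  $\pi$-periodic speed. So $\Theta$ is a global diffeomorphism of the line, $u$ is periodic, and
  it vanishes exactly at the multiples of $T(r) = \int_0^\pi d\phi / w_r(\phi)$, which is
  therefore the fundamental period (\<open>wave_profile\<close>, \<open>wave_solution\<close>). A solution on
  $[0,L]$ that is somewhere positive coincides with such a wave by uniqueness, $L$ is a multiple of
  $T(r)$, and fundamental period $L$ means $T(r) = L$ (\<open>positive_solution_period\<close>).

  The integrand of $T$ increases strictly with $r$, and $T(0) = 2\pi/\sqrt a$, while $T(r)$ tends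
  to infinity as $r^2$ tends to $2a$ (\<open>wave_period_strict_mono\<close>,
  \<open>wave_period_lower_bound\<close>). Hence $T(r) = L$ has a solution $r > 0$ exactly if
  $L > 2\pi/\sqrt a$, that is $a L^2 > 4\pi^2$, and the solution is unique.
\<close>

section \<open>Uniqueness for the profile equation\<close>

text \<open>
  The right-hand side of $u'' = c - a u + u^3/3$, the once integrated equation.
\<close>

definition force :: "real \<Rightarrow> real \<Rightarrow> real \<Rightarrow> real" where
  "force a c y = c - a * y + y^3 / 3"

lemma mono_of_nonneg_deriv_within:
  fixes f f' :: "real \<Rightarrow> real"
  assumes deriv: "\<And>x. x \<in> {A..B} \<Longrightarrow> (f has_real_derivative f' x) (at x within {A..B})"
    and nonneg: "\<And>x. x \<in> {A..B} \<Longrightarrow> 0 \<le> f' x"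
    and le: "A \<le> p" "p \<le> q" "q \<le> B"
  shows "f p \<le> f q"
proof (rule DERIV_nonneg_imp_increasing_open[where f = f and a = p and b = q])
  fix x assume "p < x" "x < q"
  then have "x \<in> {A..B}" "at x within {A..B} = at x"
    using le by (auto simp: at_within_Icc_at)
  then show "\<exists>y. (f has_real_derivative y) (at x) \<and> 0 \<le> y"
    using deriv nonneg by metis
next
  show "continuous_on {p..q} f"
    by (rule continuous_on_subset[OF DERIV_continuous_on[OF deriv]]) (use le in auto)
qed (fact le)

text \<open>
  Multiplying \<open>G\<close> by an exponential with rate \<open>- C\<close> or \<open>C\<close> makes it nonincreasing or
  nondecreasing, so its zero propagates to the right and to the left. Both directions are needed:
  the comparison with a constant starts at an interior maximum.
\<close>

lemma gronwall_zero:
  fixes G G' :: "real \<Rightarrow> real"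
  assumes deriv: "\<And>x. x \<in> {A..B} \<Longrightarrow> (G has_real_derivative G' x) (at x within {A..B})"
    and bound: "\<And>x. x \<in> {A..B} \<Longrightarrow> \<bar>G' x\<bar> \<le> C * G x"
    and nonneg: "\<And>x. x \<in> {A..B} \<Longrightarrow> 0 \<le> G x"
    and x0: "x0 \<in> {A..B}" "G x0 = 0"
    and x: "x \<in> {A..B}"
  shows "G x = 0"
proof -
  have "exp (k * x) * G x \<le> 0" if k: "k = (if x0 \<le> x then - C else C)" for k
  proof -
    define s where "s = (if x0 \<le> x then - 1 else (1::real))"
    define H where "H = (\<lambda>y. s * (exp (s * C * y) * G y))"
    have d: "(H has_real_derivative exp (s * C * y) * (C * G y + s * G' y)) (at y within {A..B})"
      if "y \<in> {A..B}" for y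
      unfolding H_def using that
      by (auto intro!: derivative_eq_intros deriv simp: algebra_simps s_def)
    have n: "0 \<le> exp (s * C * y) * (C * G y + s * G' y)" if "y \<in> {A..B}" for y
      using bound[OF that] by (auto simp: s_def)
    have "H x0 \<le> H x" if "x0 \<le> x"
      by (rule mono_of_nonneg_deriv_within[of A B H, OF d n]) (use that x0 x in auto)
    moreover have "H x \<le> H x0" if "x < x0"
      by (rule mono_of_nonneg_deriv_within[of A B H, OF d n]) (use that x0 x in auto)
    ultimately show ?thesis using x0(2) k by (auto simp: H_def s_def split: if_splits)
  qed
  then show ?thesis using nonneg[OF x] by (smt (verit) exp_gt_zero mult_pos_pos)
qed

text \<open>
  On the compact interval both solutions are bounded, so the cubic is Lipschitz between them, and
  the squared distance of the two phase-space curves satisfies a linear differential inequality.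
\<close>

lemma profile_equation_unique:
  fixes v v1 w w1 :: "real \<Rightarrow> real"
  assumes v: "\<And>x. x \<in> {A..B} \<Longrightarrow> (v has_real_derivative v1 x) (at x within {A..B})"
      "\<And>x. x \<in> {A..B} \<Longrightarrow> (v1 has_real_derivative force a c (v x)) (at x within {A..B})"
    and w: "\<And>x. x \<in> {A..B} \<Longrightarrow> (w has_real_derivative w1 x) (at x within {A..B})"
      "\<And>x. x \<in> {A..B} \<Longrightarrow> (w1 has_real_derivative force a c (w x)) (at x within {A..B})"
    and x0: "x0 \<in> {A..B}" "v x0 = w x0" "v1 x0 = w1 x0"
    and x: "x \<in> {A..B}"
  shows "v x = w x"
proof -
  have "bounded (v ` {A..B})" "bounded (w ` {A..B})"
    by (intro compact_imp_bounded compact_continuous_image DERIV_continuous_on[OF v(1)]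
          DERIV_continuous_on[OF w(1)]; simp)+
  then obtain M1 M2 where "\<And>y. y \<in> {A..B} \<Longrightarrow> \<bar>v y\<bar> \<le> M1" "\<And>y. y \<in> {A..B} \<Longrightarrow> \<bar>w y\<bar> \<le> M2"
    unfolding bounded_iff by (metis image_eqI real_norm_def)
  then obtain M where M: "\<And>y. y \<in> {A..B} \<Longrightarrow> \<bar>v y\<bar> \<le> M" "\<And>y. y \<in> {A..B} \<Longrightarrow> \<bar>w y\<bar> \<le> M"
    using that[of "max M1 M2"] by fastforce
  define K where "K = \<bar>a\<bar> + M\<^sup>2"
  have K0: "0 \<le> K" by (simp add: K_def)
  have lip: "\<bar>force a c (v y) - force a c (w y)\<bar> \<le> K * \<bar>v y - w y\<bar>" if y: "y \<in> {A..B}" for y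
  proof -
    have sq: "(v y)\<^sup>2 \<le> M\<^sup>2" "(w y)\<^sup>2 \<le> M\<^sup>2"
      using power_mono[OF M(1)[OF y], of 2] power_mono[OF M(2)[OF y], of 2] by simp_all
    have "\<bar>v y * w y\<bar> \<le> M\<^sup>2" unfolding abs_mult power2_eq_square
      by (rule mult_mono) (use M[OF y] in auto)
    then have "v y * w y \<le> M\<^sup>2" "- (v y * w y) \<le> M\<^sup>2" by (simp_all add: abs_le_iff)
    moreover define X where "X = (v y)\<^sup>2 + v y * w y + (w y)\<^sup>2"
    ultimately have X: "X \<le> 3 * M\<^sup>2" "- X \<le> 3 * M\<^sup>2"
      using sq zero_le_power2[of "v y"] zero_le_power2[of "w y"] by linarith+
    then have "\<bar>- a + X / 3\<bar> \<le> K" unfolding K_def by linarith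
    moreover have "force a c (v y) - force a c (w y)
        = (- a + X / 3) * (v y - w y)"
      by (simp add: X_def force_def field_simps power2_eq_square power3_eq_cube)
    ultimately show ?thesis by (metis abs_ge_zero abs_mult mult_right_mono)
  qed
  define G where "G = (\<lambda>y. (v y - w y)\<^sup>2 + (v1 y - w1 y)\<^sup>2)"
  define G' where "G' = (\<lambda>y. 2 * (v1 y - w1 y) * ((v y - w y) + (force a c (v y) - force a c (w y))))"
  have "G x = 0"
  proof (rule gronwall_zero[where G = G and G' = G' and C = "1 + K"])
    fix y assume y: "y \<in> {A..B}"
    show "(G has_real_derivative G' y) (at y within {A..B})"
      unfolding G_def G'_def
      by (auto intro!: derivative_eq_intros v w y simp: algebra_simps)
    define p where "p = \<bar>v y - w y\<bar>"
    define q where "q = \<bar>v1 y - w1 y\<bar>"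
    have "\<bar>(v y - w y) + (force a c (v y) - force a c (w y))\<bar>
        \<le> \<bar>v y - w y\<bar> + \<bar>force a c (v y) - force a c (w y)\<bar>"
      by (rule abs_triangle_ineq)
    also have "\<dots> \<le> p + K * p" unfolding p_def by (intro add_left_mono lip y)
    also have "\<dots> = (1 + K) * p" by (simp add: distrib_right)
    finally have "\<bar>(v y - w y) + (force a c (v y) - force a c (w y))\<bar> \<le> (1 + K) * p" .
    then have "\<bar>G' y\<bar> \<le> 2 * q * ((1 + K) * p)"
      unfolding G'_def abs_mult q_def abs_numeral by (intro mult_left_mono) auto
    also have "\<dots> = (1 + K) * (2 * p * q)" by simp
    also have "\<dots> \<le> (1 + K) * (p\<^sup>2 + q\<^sup>2)"
      by (rule mult_left_mono[OF sum_squares_bound]) (use K0 in simp)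
    also have "\<dots> = (1 + K) * G y" by (simp add: G_def p_def q_def)
    finally show "\<bar>G' y\<bar> \<le> (1 + K) * G y" .
  qed (use x0 x in \<open>auto simp: G_def\<close>)
  then show ?thesis by (simp add: G_def sum_power2_eq_zero_iff)
qed

text \<open>
  Covers periodic functions (\<open>p = 0\<close>) and phases that gain \<open>p\<close> in each period.
\<close>

lemma quasi_periodic_int:
  fixes f :: "real \<Rightarrow> real"
  assumes "\<And>x. f (x + T) = f x + p"
  shows "f (x + of_int k * T) = f x + of_int k * p"
proof (induction k rule: int_induct[where k = 0])
  case (step1 i)
  then show ?case using assms[of "x + of_int i * T"] by (simp add: algebra_simps)
next
  case (step2 i)
  then show ?case using assms[of "x + of_int (i - 1) * T"] by (simp add: algebra_simps)
qed simp

text \<open>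
  Separation of variables: \<open>\<Theta>\<close> is the inverse of the antiderivative \<open>F\<close> of \<open>1 / w\<close>. Periodicity
  of \<open>w\<close> makes \<open>F\<close> gain the constant \<open>T\<close> over each period, so \<open>F\<close> is onto and \<open>\<Theta>\<close> exists for all
  times.
\<close>

lemma periodic_flow:
  fixes w :: "real \<Rightarrow> real"
  assumes cont: "continuous_on UNIV w" and pos: "\<And>\<phi>. 0 < w \<phi>" and per: "\<And>\<phi>. w (\<phi> + p) = w \<phi>"
    and p: "0 < p"
  defines "T \<equiv> integral {0..p} (\<lambda>\<phi>. 1 / w \<phi>)"
  obtains \<Theta> where "\<And>x. (\<Theta> has_real_derivative w (\<Theta> x)) (at x)" "\<Theta> 0 = 0"
    "\<And>x. \<Theta> (x + T) = \<Theta> x + p" "inj \<Theta>" "0 < T"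
proof -
  have wne: "w \<phi> \<noteq> 0" for \<phi> using pos[of \<phi>] by simp
  have ci: "isCont (\<lambda>\<phi>. 1 / w \<phi>) \<phi>" for \<phi>
    using cont wne by (intro continuous_intros) (auto simp: continuous_on_eq_continuous_at)
  obtain F0 where F0: "\<And>\<phi>. (F0 has_vector_derivative 1 / w \<phi>) (at \<phi>)"
    using einterval_antiderivative[of "-\<infinity>" "\<infinity>" "\<lambda>\<phi>. 1 / w \<phi>"] ci by auto
  define F where "F = (\<lambda>\<phi>. F0 \<phi> - F0 0)"
  have F: "(F has_real_derivative 1 / w \<phi>) (at \<phi>)" for \<phi>
    unfolding F_def using F0[of \<phi>]
    by (auto intro!: derivative_eq_intros simp: has_real_derivative_iff_has_vector_derivative)
  have "((\<lambda>\<phi>. 1 / w \<phi>) has_integral F p - F 0) {0..p}"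
    by (rule fundamental_theorem_of_calculus)
      (use p F in \<open>auto intro: has_vector_derivative_at_within
        simp: has_real_derivative_iff_has_vector_derivative\<close>)
  then have T: "T = F p" by (simp add: T_def integral_unique F_def)
  have "F (y + p) - F y = F (0 + p) - F 0" for y
  proof (rule DERIV_isconst_all[where f = "\<lambda>\<phi>. F (\<phi> + p) - F \<phi>"], rule allI)
    fix x show "((\<lambda>\<phi>. F (\<phi> + p) - F \<phi>) has_real_derivative 0) (at x)"
      by (auto intro!: derivative_eq_intros F DERIV_chain2[where f = F] simp: per)
  qed
  then have shift: "F (\<phi> + p) = F \<phi> + T" for \<phi>
    by (simp add: T F_def algebra_simps)
  have mono: "strict_mono F"
    by (rule strict_monoI, rule DERIV_pos_imp_increasing) (use F pos in \<open>auto intro!: exI\<close>)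
  have F00: "F 0 = 0" by (simp add: F_def)
  have T0: "0 < T" using strict_monoD[OF mono p] by (simp add: T F00)
  have Fn: "F (of_int k * p) = of_int k * T" for k
    using quasi_periodic_int[of F p T 0 k, OF shift] by (simp add: F00)
  have Fcont: "isCont F x" for x using F by (rule DERIV_isCont)
  have "\<exists>x. F x = y" for y
  proof -
    obtain n where n: "\<bar>y\<bar> < real n * T" using reals_Archimedean3[OF T0] by blast
    have "\<exists>x. - real n * p \<le> x \<and> x \<le> real n * p \<and> F x = y"
      by (rule IVT) (use n Fn[of "int n"] Fn[of "- int n"] p Fcont in auto)
    then show ?thesis by blast
  qed
  then have "surj F" by (metis surjI)
  then have bij: "F (inv F y) = y" "inv F (F y) = y" for y
    using strict_mono_imp_inj_on[OF mono] by (auto simp: surj_f_inv_f)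
  have "isCont (inv F) (F x)" for x
    by (rule isCont_inverse_function[where d = 1]) (auto simp: bij Fcont)
  then have icont: "isCont (inv F) y" for y by (metis bij(1))
  show thesis
  proof (rule that)
    fix x
    have "(inv F has_real_derivative inverse (1 / w (inv F x))) (at x)"
      by (rule DERIV_inverse_function[where a = "x - 1" and b = "x + 1" and f = F])
        (use F wne bij icont in auto)
    then show "(inv F has_real_derivative w (inv F x)) (at x)" by simp
    show "inv F (x + T) = inv F x + p" by (metis bij shift)
  next
    show "inv F 0 = 0" by (metis F00 bij(2))
    show "inj (inv F)" by (metis bij(1) injI)
  qed (fact T0)
qed

section \<open>The waves with a given maximum\<close>

text \<open>
  With \<open>c = r * a / 2 - r^3 / 12\<close> and $u = r s$, the first integral factors as
  $u'^2 = r^2 s (1 - s) \, (a - \frac{r^2}{6} (1 + s + s^2))$. The last factor, at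
  $s = \sin^2 \phi$, is the radicand below; $s (1 - s)$ is absorbed by the derivative of
  $\sin^2$, which is what makes the phase equation regular.
\<close>

definition radicand :: "real \<Rightarrow> real \<Rightarrow> real \<Rightarrow> real" where
  "radicand a r \<phi> = a - r\<^sup>2 / 6 * (1 + (sin \<phi>)\<^sup>2 + (sin \<phi>)^4)"

definition phase_speed :: "real \<Rightarrow> real \<Rightarrow> real \<Rightarrow> real" where
  "phase_speed a r \<phi> = sqrt (radicand a r \<phi>) / 2"

text \<open>
  The time in which the phase advances by $\pi$, hence $\sin^2$ of it runs once from $0$ to $1$
  and back.
\<close>

definition wave_period :: "real \<Rightarrow> real \<Rightarrow> real" where
  "wave_period a r = integral {0..pi} (\<lambda>\<phi>. 1 / phase_speed a r \<phi>)"

lemma radicand_pos: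
  assumes "r\<^sup>2 < 2 * a"
  shows "0 < radicand a r \<phi>"
proof -
  have s: "(sin \<phi>)\<^sup>2 \<le> 1" by (simp add: abs_square_le_1)
  then have "((sin \<phi>)\<^sup>2)\<^sup>2 \<le> 1" by (rule power_le_one[rotated]) simp
  then have "(sin \<phi>)^4 \<le> 1" by (simp flip: power_mult)
  then have "1 + (sin \<phi>)\<^sup>2 + (sin \<phi>)^4 \<le> 3" using s by simp
  then have "r\<^sup>2 / 6 * (1 + (sin \<phi>)\<^sup>2 + (sin \<phi>)^4) \<le> r\<^sup>2 / 6 * 3"
    by (intro mult_left_mono) auto
  then show ?thesis using assms by (simp add: radicand_def)
qed

lemma phase_speed_pos: "r\<^sup>2 < 2 * a \<Longrightarrow> 0 < phase_speed a r \<phi>"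
  by (simp add: phase_speed_def radicand_pos)

lemma continuous_phase_speed: "continuous_on S (phase_speed a r)"
  unfolding phase_speed_def radicand_def by (intro continuous_intros) auto

text \<open>
  The wave $u = r \sin^2\Theta$, with \<open>\<Theta>\<close> moving at the phase speed. Its zeros are the points where
  \<open>\<Theta>\<close> is a multiple of $\pi$; these double zeros, at multiples of the period, are what
  identifies the fundamental period later.
\<close>

lemma wave_profile:
  assumes r: "0 < r" "r\<^sup>2 < 2 * a"
  obtains u u1 where
    "\<And>x. (u has_real_derivative u1 x) (at x)"
    "\<And>x. (u1 has_real_derivative force a (r * a / 2 - r^3 / 12) (u x)) (at x)"
    "u 0 = 0" "\<And>x. u x = 0 \<Longrightarrow> u1 x = 0"
    "0 < wave_period a r" "\<And>x. u (x + wave_period a r) = u x"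
    "\<And>x. u x = 0 \<Longrightarrow> \<exists>k::int. x = of_int k * wave_period a r"
proof -
  define w where "w = phase_speed a r"
  define T where "T = wave_period a r"
  have wpos: "0 < w \<phi>" for \<phi> using phase_speed_pos r by (simp add: w_def)
  have wcont: "continuous_on UNIV w" by (simp add: w_def continuous_phase_speed)
  have wper: "w (\<phi> + pi) = w \<phi>" for \<phi> by (simp add: w_def phase_speed_def radicand_def)
  obtain \<Theta> where \<Theta>: "\<And>x. (\<Theta> has_real_derivative w (\<Theta> x)) (at x)" "\<Theta> 0 = 0"
    "\<And>x. \<Theta> (x + T) = \<Theta> x + pi" "inj \<Theta>" "0 < T"
    using periodic_flow[OF wcont wpos wper pi_gt_zero]
    unfolding T_def wave_period_def w_def by blast
  \<comment> \<open>The derivative of \<open>w\<close>, written with \<open>w\<close> itself in the denominator instead of a square root.\<close>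
  define w' where "w' = (\<lambda>\<phi>. - (r\<^sup>2 / 3) * (sin \<phi> * cos \<phi> * (1 + 2 * (sin \<phi>)\<^sup>2)) / (8 * w \<phi>))"
  have dw: "(w has_real_derivative w' \<phi>) (at \<phi>)" for \<phi>
  proof -
    have R: "0 < radicand a r \<phi>" using radicand_pos r by simp
    have "((radicand a r) has_real_derivative
        - (r\<^sup>2 / 3) * (sin \<phi> * cos \<phi> * (1 + 2 * (sin \<phi>)\<^sup>2))) (at \<phi>)"
      unfolding radicand_def
      by (auto intro!: derivative_eq_intros simp: field_simps power2_eq_square power3_eq_cube
          power4_eq_xxxx)
    then show ?thesis
      using R unfolding w_def w'_def phase_speed_def
      by (auto intro!: derivative_eq_intros simp: field_simps)
  qed
  define u where "u = (\<lambda>x. r * (sin (\<Theta> x))\<^sup>2)"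
  define u1 where "u1 = (\<lambda>x. 2 * r * (sin (\<Theta> x) * cos (\<Theta> x) * w (\<Theta> x)))"
  have zero: "sin (\<Theta> x) = 0" if "u x = 0" for x using that r by (simp add: u_def)
  show thesis
  proof (rule that[of u u1])
    fix x
    show "(u has_real_derivative u1 x) (at x)"
      unfolding u_def u1_def by (auto intro!: derivative_eq_intros \<Theta>(1))
    have w2: "(w \<phi>)\<^sup>2 = radicand a r \<phi> / 4" for \<phi>
      using radicand_pos[OF r(2), of \<phi>] by (simp add: w_def phase_speed_def power_divide)
    have c2: "(cos \<phi>)\<^sup>2 = 1 - (sin \<phi>)\<^sup>2" for \<phi> :: real by (simp add: cos_squared_eq)
    define S where "S = sin (\<Theta> x)"
    define C where "C = cos (\<Theta> x)"
    define W where "W = w (\<Theta> x)"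
    have W: "W \<noteq> 0" using wpos[of "\<Theta> x"] by (simp add: W_def)
    have "(u1 has_real_derivative
        2 * r * ((C * W * C - S * W * S) * W + S * C * (w' (\<Theta> x) * W))) (at x)"
      unfolding u1_def S_def C_def W_def
      by (auto intro!: derivative_eq_intros \<Theta>(1) DERIV_chain2[OF dw] simp: algebra_simps)
    also have "2 * r * ((C * W * C - S * W * S) * W + S * C * (w' (\<Theta> x) * W))
      = 2 * r * ((C\<^sup>2 - S\<^sup>2) * W\<^sup>2 - S\<^sup>2 * C\<^sup>2 * (r\<^sup>2 / 24) * (1 + 2 * S\<^sup>2))"
      using W unfolding w'_def S_def[symmetric] C_def[symmetric] W_def[symmetric]
      by (simp add: field_simps power2_eq_square)
    also have "\<dots> = force a (r * a / 2 - r^3 / 12) (r * S\<^sup>2)"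
    proof -
      have "C\<^sup>2 = 1 - S\<^sup>2" "W\<^sup>2 = (a - r\<^sup>2 / 6 * (1 + S\<^sup>2 + S^4)) / 4"
        by (simp_all add: C_def S_def W_def c2 w2 radicand_def)
      then show ?thesis
        by (simp add: force_def field_simps) algebra
    qed
    finally show "(u1 has_real_derivative force a (r * a / 2 - r^3 / 12) (u x)) (at x)"
      by (simp add: u_def S_def)
    show "u (x + wave_period a r) = u x"
      by (simp add: u_def \<Theta>(3)[unfolded T_def])
  next
    show "u 0 = 0" by (simp add: u_def \<Theta>)
    show "0 < wave_period a r" using \<Theta>(5) by (simp add: T_def)
  next
    fix x assume ux: "u x = 0"
    show "u1 x = 0" using zero[OF ux] by (simp add: u1_def)
    obtain k :: int where k: "\<Theta> x = of_int k * pi"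
      using zero[OF ux] by (auto simp: sin_zero_iff_int2)
    also have "\<dots> = \<Theta> (of_int k * T)"
      using quasi_periodic_int[of \<Theta> T pi 0 k] \<Theta>(2,3) by simp
    finally have "x = of_int k * T" using \<Theta>(4) by (simp add: inj_eq)
    then show "\<exists>k::int. x = of_int k * wave_period a r" by (auto simp: T_def)
  qed
qed

section \<open>Dependence of the period on the amplitude\<close>

lemma wave_period_strict_mono:
  assumes "0 \<le> r" "r < r'" "r'\<^sup>2 < 2 * a"
  shows "wave_period a r < wave_period a r'"
proof -
  have sq: "r\<^sup>2 < r'\<^sup>2" using assms by (simp add: power_strict_mono)
  have pos: "0 < phase_speed a r \<phi>" "0 < phase_speed a r' \<phi>" for \<phi>
    using phase_speed_pos sq assms(3) by auto
  show ?thesis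
    unfolding wave_period_def
  proof (rule integral_less_real)
    show "continuous_on {0..pi} (\<lambda>\<phi>. 1 / phase_speed a r \<phi>)"
        "continuous_on {0..pi} (\<lambda>\<phi>. 1 / phase_speed a r' \<phi>)"
      by (intro continuous_intros continuous_phase_speed; use pos in \<open>auto simp: less_le\<close>)+
  next
    fix \<phi> :: real
    have "radicand a r' \<phi> < radicand a r \<phi>"
      unfolding radicand_def using sq
      by (intro diff_strict_left_mono mult_strict_right_mono) (auto simp: add_pos_nonneg)
    then have "phase_speed a r' \<phi> < phase_speed a r \<phi>" by (simp add: phase_speed_def)
    then show "1 / phase_speed a r \<phi> < 1 / phase_speed a r' \<phi>"
      using pos by (intro divide_strict_left_mono) auto
  qed (use pi_gt_zero in \<open>simp del: pi_gt_zero\<close>)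
qed

lemma wave_period_zero: "wave_period a 0 = 2 * pi / sqrt a"
  by (simp add: wave_period_def phase_speed_def radicand_def)

lemma continuous_wave_period:
  "continuous_on {r. r\<^sup>2 < 2 * a} (wave_period a)"
proof -
  have "continuous_on ({r. r\<^sup>2 < 2 * a} \<times> cbox 0 pi) (\<lambda>(r, \<phi>). 1 / phase_speed a r \<phi>)"
    unfolding case_prod_unfold
  proof (rule continuous_on_divide)
    show "continuous_on ({r. r\<^sup>2 < 2 * a} \<times> cbox 0 pi) (\<lambda>x. phase_speed a (fst x) (snd x))"
      unfolding phase_speed_def radicand_def by (intro continuous_intros) auto
    show "\<forall>x\<in>{r. r\<^sup>2 < 2 * a} \<times> cbox 0 pi. phase_speed a (fst x) (snd x) \<noteq> 0"
      using phase_speed_pos by (auto simp: less_le)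
  qed (rule continuous_on_const)
  from integral_continuous_on_param[OF this] show ?thesis
    by (simp add: wave_period_def[abs_def])
qed

text \<open>
  Near $\phi = \pi/2$ the radicand degenerates as the amplitude approaches $\sqrt{2a}$. For
  $r^2 = 2a(1 - d^2)$ and $\phi$ in $[0, \pi/2]$ it is at most $a (d + \cos\phi)^2$, and
  $\cos\phi \le \pi/2 - \phi$, so the integral over this half alone dominates a logarithm that is unbounded as $d$ tends to $0$.
\<close>

lemma wave_period_lower_bound:
  assumes a: "0 < a" and d: "0 < d" "d \<le> 1"
  shows "2 / sqrt a * ln (1 + pi / (2 * d)) \<le> wave_period a (sqrt (2 * a * (1 - d\<^sup>2)))"
proof -
  define r where "r = sqrt (2 * a * (1 - d\<^sup>2))"
  have "d\<^sup>2 \<le> 1" using d by (simp add: power_le_one)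
  then have r2: "r\<^sup>2 = 2 * a * (1 - d\<^sup>2)" using a by (simp add: r_def)
  also have "\<dots> < 2 * a" using a d by simp
  finally have r2l: "r\<^sup>2 < 2 * a" .
  have pos: "0 < phase_speed a r \<phi>" for \<phi> using phase_speed_pos r2l by auto
  define h where "h = (\<lambda>\<phi>. 2 / sqrt a * (1 / (d + pi / 2 - \<phi>)))"
  have cont: "continuous_on S (\<lambda>\<phi>. 1 / phase_speed a r \<phi>)" for S
    by (intro continuous_intros continuous_phase_speed; use pos in \<open>auto simp: less_le\<close>)
  have "((\<lambda>\<phi>. - ln (d + pi / 2 - \<phi>)) has_real_derivative 1 / (d + pi / 2 - \<phi>)) (at \<phi>)"
    if "\<phi> \<le> pi / 2" for \<phi>
    using that d by (auto intro!: derivative_eq_intros)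
  then have "((\<lambda>\<phi>. 1 / (d + pi / 2 - \<phi>)) has_integral
      (- ln (d + pi / 2 - pi / 2) - - ln (d + pi / 2 - 0))) {0..pi/2}"
    by (intro fundamental_theorem_of_calculus)
      (auto intro: has_vector_derivative_at_within
        simp: has_real_derivative_iff_has_vector_derivative)
  from has_integral_mult_right[OF this, of "2 / sqrt a"]
  have hint: "(h has_integral 2 / sqrt a * (ln (d + pi / 2) - ln d)) {0..pi/2}"
    by (simp add: h_def)
  have "ln (1 + pi / (2 * d)) = ln ((d + pi / 2) / d)" using d by (simp add: field_simps)
  also have "\<dots> = ln (d + pi / 2) - ln d" using d by (simp add: ln_div add_pos_pos add_pos_nonneg less_imp_neq[symmetric])
  finally have "2 / sqrt a * ln (1 + pi / (2 * d)) = integral {0..pi/2} h"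
    using integral_unique[OF hint] by simp
  also have "\<dots> \<le> integral {0..pi/2} (\<lambda>\<phi>. 1 / phase_speed a r \<phi>)"
  proof (rule integral_le)
    show "h integrable_on {0..pi/2}" using hint by blast
    show "(\<lambda>\<phi>. 1 / phase_speed a r \<phi>) integrable_on {0..pi/2}"
      by (intro integrable_continuous_interval cont)
    fix \<phi> :: real assume \<phi>: "\<phi> \<in> {0..pi/2}"
    define s where "s = (sin \<phi>)\<^sup>2"
    have s: "0 \<le> s" "s \<le> 1" by (simp_all add: s_def abs_square_le_1)
    have c: "0 \<le> cos \<phi>" "cos \<phi> \<le> pi / 2 - \<phi>"
      using \<phi> sin_x_le_x[of "pi/2 - \<phi>"] cos_ge_zero[of \<phi>] by (simp_all add: sin_cos_eq)
    have "radicand a r \<phi> = a * (d\<^sup>2 + (1 - d\<^sup>2) * ((1 - s) * (2 + s) / 3))"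
      unfolding radicand_def r2 s_def by (simp add: field_simps power2_eq_square power4_eq_xxxx)
    also have "\<dots> \<le> a * (d\<^sup>2 + 1 * ((1 - s) * 3 / 3))"
      using a d s by (intro mult_left_mono add_left_mono mult_mono divide_right_mono) auto
    also have "\<dots> = a * (d\<^sup>2 + (cos \<phi>)\<^sup>2)" by (simp add: s_def cos_squared_eq)
    also have "\<dots> \<le> a * (d + cos \<phi>)\<^sup>2"
      using a d c by (intro mult_left_mono) (auto simp: power2_sum)
    finally have "sqrt (radicand a r \<phi>) \<le> sqrt a * (d + cos \<phi>)"
      using d c by (metis add_nonneg_nonneg less_imp_le real_sqrt_le_iff real_sqrt_mult real_sqrt_unique)
    also have "\<dots> \<le> sqrt a * (d + pi / 2 - \<phi>)" using a c by (intro mult_left_mono) auto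
    finally have "phase_speed a r \<phi> \<le> sqrt a * (d + pi / 2 - \<phi>) / 2" by (simp add: phase_speed_def)
    then have "1 / (sqrt a * (d + pi / 2 - \<phi>) / 2) \<le> 1 / phase_speed a r \<phi>"
      using pos[of \<phi>] by (intro divide_left_mono mult_pos_pos) auto
    then show "h \<phi> \<le> 1 / phase_speed a r \<phi>" by (simp add: h_def)
  qed
  also have "\<dots> \<le> integral {0..pi} (\<lambda>\<phi>. 1 / phase_speed a r \<phi>)"
    by (rule integral_subset_le)
      (use pos in \<open>auto intro!: integrable_continuous_interval cont simp: less_imp_le\<close>)
  finally show ?thesis by (simp add: wave_period_def r_def)
qed

text \<open>
  Intermediate value theorem between amplitude $0$ and an amplitude whose period exceeds \<open>L\<close> by the
  logarithmic bound.
\<close>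

lemma wave_period_attained:
  assumes a: "0 < a" and L: "2 * pi / sqrt a < L"
  obtains r where "0 < r" "r\<^sup>2 < 2 * a" "wave_period a r = L"
proof -
  define E where "E = exp (sqrt a * L / 2)"
  \<comment> \<open>Chosen so that the logarithm in the lower bound exceeds \<open>sqrt a * L / 2\<close>.\<close>
  define d where "d = min 1 (pi / (2 * E))"
  have E: "0 < E" by (simp add: E_def)
  have d: "0 < d" "d \<le> 1" using E by (auto simp: d_def)
  have "E \<le> pi / (2 * d)" using d E by (simp add: d_def field_simps min_def split: if_splits)
  then have "E < 1 + pi / (2 * d)" by simp
  then have "sqrt a * L / 2 < ln (1 + pi / (2 * d))"
    using E by (metis E_def ln_exp ln_less_cancel_iff less_trans)
  then have "L \<le> 2 / sqrt a * ln (1 + pi / (2 * d))" using a by (simp add: field_simps)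
  also note wave_period_lower_bound[OF a d]
  finally have up: "L \<le> wave_period a (sqrt (2 * a * (1 - d\<^sup>2)))" .
  define R where "R = sqrt (2 * a * (1 - d\<^sup>2))"
  have "d\<^sup>2 \<le> 1" using d by (simp add: power_le_one)
  then have R: "0 \<le> R" "R\<^sup>2 < 2 * a" using a d by (simp_all add: R_def)
  have "x\<^sup>2 < 2 * a" if "0 \<le> x" "x \<le> R" for x
    using power_mono[OF that(2,1), of 2] R by linarith
  then have "continuous_on {0..R} (wave_period a)"
    by (intro continuous_on_subset[OF continuous_wave_period]) auto
  then obtain r where r: "0 \<le> r" "r \<le> R" "wave_period a r = L"
    using IVT'[of "wave_period a" 0 L R] up L R(1) by (auto simp: wave_period_zero R_def)
  have "r \<noteq> 0" using r(3) L by (auto simp: wave_period_zero)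
  moreover have "r\<^sup>2 < 2 * a" using power_mono[OF r(2,1), of 2] R by linarith
  ultimately show thesis using that[of r] r by simp
qed

section \<open>Solutions of the boundary value problem\<close>

text \<open>
  The energy constant vanishes because \<open>v\<close> and its derivative vanish at \<open>L\<close>. Evaluated at \<open>0\<close>,
  the energy identity then yields the missing initial condition \<open>v1 0 = 0\<close>.
\<close>

lemma solution_first_integrals:
  assumes L: "0 < L" and sol: "is_solution a L v"
  obtains v1 c where
    "\<And>x. x \<in> {0..L} \<Longrightarrow> (v has_real_derivative v1 x) (at x within {0..L})"
    "\<And>x. x \<in> {0..L} \<Longrightarrow> (v1 has_real_derivative force a c (v x)) (at x within {0..L})"
    "\<And>x. x \<in> {0..L} \<Longrightarrow> (v1 x)\<^sup>2 = v x * (2 * c - a * v x + (v x)^3 / 6)"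
    "v 0 = 0" "v1 0 = 0" "v L = 0"
proof -
  obtain v1 v2 v3 where
    d: "\<And>x. x \<in> {0..L} \<Longrightarrow> (v has_real_derivative v1 x) (at x within {0..L})"
      "\<And>x. x \<in> {0..L} \<Longrightarrow> (v1 has_real_derivative v2 x) (at x within {0..L})"
      "\<And>x. x \<in> {0..L} \<Longrightarrow> (v2 has_real_derivative v3 x) (at x within {0..L})"
    and eq: "\<And>x. x \<in> {0..L} \<Longrightarrow> v3 x + a * v1 x - (v x)\<^sup>2 * v1 x = 0"
    and bc: "v 0 = 0" "v L = 0" "v1 L = 0"
    using sol unfolding is_solution_def C3_on_with_def by blast
  have "((\<lambda>x. v2 x + a * v x - (v x)^3 / 3) has_real_derivative 0) (at x within {0..L})"
    if x: "x \<in> {0..L}" for x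
    using eq[OF x] by (auto intro!: derivative_eq_intros d x simp: algebra_simps)
  from has_field_derivative_zero_constant[OF _ this]
  obtain c where c: "\<And>x. x \<in> {0..L} \<Longrightarrow> v2 x + a * v x - (v x)^3 / 3 = c"
    by (auto simp: convex_real_interval)
  have v2: "v2 x = force a c (v x)" if "x \<in> {0..L}" for x
    using c[OF that] by (simp add: force_def)
  define En where "En = (\<lambda>x. (v1 x)\<^sup>2 - v x * (2 * c - a * v x + (v x)^3 / 6))"
  have "(En has_real_derivative 0) (at x within {0..L})" if x: "x \<in> {0..L}" for x
  proof -
    have "(En has_real_derivative 2 * v1 x * (v2 x - force a c (v x))) (at x within {0..L})"
      unfolding En_def force_def
      by (auto intro!: derivative_eq_intros d x
          simp: field_simps power2_eq_square power3_eq_cube)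
    then show ?thesis using v2[OF x] by simp
  qed
  from has_field_derivative_zero_constant[OF _ this]
  obtain e where e: "\<And>x. x \<in> {0..L} \<Longrightarrow> En x = e" by (auto simp: convex_real_interval)
  have "e = 0" using e[of L] bc L by (simp add: En_def)
  then have energy: "(v1 x)\<^sup>2 = v x * (2 * c - a * v x + (v x)^3 / 6)" if "x \<in> {0..L}" for x
    using e[OF that] by (simp add: En_def)
  show thesis
    by (rule that[OF d(1) _ energy bc(1) _ bc(2)])
      (use energy[of 0] bc L d(2) v2 in auto)
qed

text \<open>
  Here \<open>r\<close> is the maximum of \<open>v\<close>. It determines the integration constant, because the derivative
  vanishes there.
\<close>

lemma positive_solution_profile:
  assumes L: "0 < L" and sol: "is_solution a L v" and pos: "x0 \<in> {0..L}" "0 < v x0"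
  obtains r v1 where "0 < r" "r\<^sup>2 < 2 * a"
    "\<And>x. x \<in> {0..L} \<Longrightarrow> (v has_real_derivative v1 x) (at x within {0..L})"
    "\<And>x. x \<in> {0..L} \<Longrightarrow>
      (v1 has_real_derivative force a (r * a / 2 - r^3 / 12) (v x)) (at x within {0..L})"
    "v 0 = 0" "v1 0 = 0" "v L = 0"
proof -
  obtain v1 c where
    d: "\<And>x. x \<in> {0..L} \<Longrightarrow> (v has_real_derivative v1 x) (at x within {0..L})"
      "\<And>x. x \<in> {0..L} \<Longrightarrow> (v1 has_real_derivative force a c (v x)) (at x within {0..L})"
    and en: "\<And>x. x \<in> {0..L} \<Longrightarrow> (v1 x)\<^sup>2 = v x * (2 * c - a * v x + (v x)^3 / 6)"
    and bc: "v 0 = 0" "v1 0 = 0" "v L = 0"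
    by (rule solution_first_integrals[OF L sol]) (rule that; assumption)
  have vc: "continuous_on {0..L} v" by (rule DERIV_continuous_on[OF d(1)])
  obtain m where m: "m \<in> {0..L}" "\<And>x. x \<in> {0..L} \<Longrightarrow> v x \<le> v m"
    using continuous_attains_sup[OF _ _ vc] L by auto
  define r where "r = v m"
  have r0: "0 < r" using m(2)[OF pos(1)] pos(2) by (simp add: r_def)
  then have m': "0 < m" "m < L" using m(1) bc by (auto simp: r_def less_le)
  have dm: "(v has_real_derivative v1 m) (at m)"
    using d(1)[OF m(1)] m' by (simp add: at_within_Icc_at)
  have "v1 m = 0"
    by (rule DERIV_local_max[OF dm, of "min m (L - m)"]) (use m m' in \<open>auto simp: abs_less_iff\<close>)
  then have "2 * c - a * r + r^3 / 6 = 0" using en[OF m(1)] r0 by (simp add: r_def)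
  then have c: "c = r * a / 2 - r^3 / 12" by (simp add: field_simps)
  have fac: "2 * c - a * y + y^3 / 6 = (r - y) * (a - (r\<^sup>2 + r * y + y\<^sup>2) / 6)" for y
    by (simp add: c field_simps power2_eq_square power3_eq_cube)
  have ge: "(r\<^sup>2 + r * y + y\<^sup>2) / 6 \<le> a" if y: "0 < y" "y < r" for y
  proof -
    obtain x where x: "0 \<le> x" "x \<le> m" "v x = y"
      using IVT'[of v 0 y m] y bc m' continuous_on_subset[OF vc, of "{0..m}"]
      by (auto simp: r_def)
    have "0 \<le> v x * (2 * c - a * v x + (v x)^3 / 6)"
      using en[of x] x m' by (metis atLeastAtMost_iff less_eq_real_def order_trans zero_le_power2)
    then show ?thesis using y by (simp add: fac x(3) zero_le_mult_iff)
  qed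
  \<comment> \<open>The bound holds for every value \<open>y\<close> below \<open>r\<close>; let \<open>y\<close> tend to \<open>r\<close>.\<close>
  have "r\<^sup>2 \<le> 2 * a"
  proof (rule tendsto_le[OF _ tendsto_const])
    show "((\<lambda>y. (r\<^sup>2 + r * y + y\<^sup>2) / 3) \<longlongrightarrow> r\<^sup>2) (at_left r)"
      by (auto intro!: tendsto_eq_intros simp: power2_eq_square)
    show "\<forall>\<^sub>F y in at_left r. (r\<^sup>2 + r * y + y\<^sup>2) / 3 \<le> 2 * a"
      unfolding eventually_at_left[OF r0] using r0 ge by (intro exI[of _ 0]) force
  qed simp
  \<comment> \<open>For equality the polynomial has a double root at \<open>r\<close>, so the constant \<open>r\<close> is an equilibrium
    that \<open>v\<close> would reach at \<open>m\<close> with zero velocity.\<close>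
  moreover have "r\<^sup>2 \<noteq> 2 * a"
  proof
    assume eq: "r\<^sup>2 = 2 * a"
    have "force a c r = 0" using eq unfolding c force_def
      by (simp add: power3_eq_cube power2_eq_square field_simps)
    then have "v 0 = r"
      by (intro profile_equation_unique[of 0 L v v1 a c "\<lambda>_. r" "\<lambda>_. 0" m 0, OF d])
        (use m \<open>v1 m = 0\<close> L in \<open>auto simp: r_def\<close>)
    then show False using r0 bc by simp
  qed
  ultimately have "r\<^sup>2 < 2 * a" by simp
  then show thesis
    using that[OF r0 _ d(1)] d(2) bc by (simp add: c)
qed

lemma periodic_extension_eq:
  assumes L: "0 < L" and U: "\<And>x. U (x + L) = U x" and eq: "\<And>x. x \<in> {0..L} \<Longrightarrow> u x = U x"
  shows "periodic_extension L u = U"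
proof
  fix x
  have "x - L * of_int \<lfloor>x / L\<rfloor> = L * frac (x / L)"
    using L by (simp add: frac_def right_diff_distrib)
  moreover have "frac (x / L) < 1" by (rule frac_lt_1)
  ultimately have "x - L * of_int \<lfloor>x / L\<rfloor> \<in> {0..L}" using L by (simp add: mult_le_cancel_left1)
  then have "periodic_extension L u x = U (x - L * of_int \<lfloor>x / L\<rfloor>)"
    by (simp add: periodic_extension_def eq)
  also have "\<dots> = U x"
    using quasi_periodic_int[of U L 0 x "- \<lfloor>x / L\<rfloor>"] U by (simp add: mult.commute)
  finally show "periodic_extension L u x = U x" .
qed

text \<open>
  The periodic extension of \<open>v\<close> is a wave on the whole line. Since \<open>v\<close> vanishes at \<open>L\<close>, the number
  \<open>L\<close> is a positive multiple of the wave period, and minimality of \<open>L\<close> leaves only the multiple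
  one.
\<close>

lemma positive_solution_period:
  assumes L: "0 < L" and v: "is_nontrivial_solution_with_fundamental_period_L a L v"
    and pos: "x0 \<in> {0..L}" "0 < v x0"
  obtains r v1 where "0 < r" "r\<^sup>2 < 2 * a" "wave_period a r = L"
    "\<And>x. x \<in> {0..L} \<Longrightarrow> (v has_real_derivative v1 x) (at x within {0..L})"
    "\<And>x. x \<in> {0..L} \<Longrightarrow>
      (v1 has_real_derivative force a (r * a / 2 - r^3 / 12) (v x)) (at x within {0..L})"
    "v 0 = 0" "v1 0 = 0"
proof -
  have sol: "is_solution a L v" and fp: "is_fundamental_period (periodic_extension L v) L"
    using v by (auto simp: is_nontrivial_solution_with_fundamental_period_L_def)
  obtain r v1 where r: "0 < r" "r\<^sup>2 < 2 * a" and
    d: "\<And>x. x \<in> {0..L} \<Longrightarrow> (v has_real_derivative v1 x) (at x within {0..L})"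
      "\<And>x. x \<in> {0..L} \<Longrightarrow>
        (v1 has_real_derivative force a (r * a / 2 - r^3 / 12) (v x)) (at x within {0..L})"
    and bc: "v 0 = 0" "v1 0 = 0" "v L = 0"
    by (rule positive_solution_profile[where v = v, OF L sol pos]) (rule that; assumption)
  define T where "T = wave_period a r"
  obtain u u1 where u: "\<And>x. (u has_real_derivative u1 x) (at x)"
    "\<And>x. (u1 has_real_derivative force a (r * a / 2 - r^3 / 12) (u x)) (at x)"
    "u 0 = 0" "\<And>x. u x = 0 \<Longrightarrow> u1 x = 0"
    "0 < T" "\<And>x. u (x + T) = u x"
    "\<And>x. u x = 0 \<Longrightarrow> \<exists>k::int. x = of_int k * T"
    by (rule wave_profile[OF r, folded T_def]) (rule that; assumption)
  have vu: "v x = u x" if "x \<in> {0..L}" for x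
    by (rule profile_equation_unique[of 0 L v v1 a "r * a / 2 - r^3 / 12" u u1 0 x, OF d])
      (use that L bc u in \<open>auto intro: has_field_derivative_at_within\<close>)
  have "u L = 0" using vu[of L] L bc by simp
  then obtain k :: int where k: "L = of_int k * T" using u(7) by blast
  have "u (x + L) = u x" for x
    using quasi_periodic_int[of u T 0 x k] u(6) by (simp add: k)
  then have ext: "periodic_extension L v = u" by (rule periodic_extension_eq[where U = u, OF L _ vu])
  have "is_period u T" using u(5,6) by (simp add: is_period_def)
  then have "L \<le> T" using fp by (simp add: is_fundamental_period_def ext)
  moreover have "1 \<le> k" using L u(5) by (simp add: k zero_less_mult_iff)
  then have "1 * T \<le> of_int k * T" using u(5) by (intro mult_right_mono) auto
  ultimately have "wave_period a r = L" by (simp add: k T_def)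
  then show thesis by (rule that[OF r _ d bc(1,2)])
qed

text \<open>
  Any period of the wave is a zero of it, as \<open>0\<close> is, hence a positive multiple of \<open>L\<close>.
\<close>

lemma wave_solution:
  assumes L: "0 < L" and r: "0 < r" "r\<^sup>2 < 2 * a" and T: "wave_period a r = L"
  shows "\<exists>u. is_nontrivial_solution_with_fundamental_period_L a L u"
proof -
  define c where "c = r * a / 2 - r^3 / 12"
  obtain u u1 where u: "\<And>x. (u has_real_derivative u1 x) (at x)"
    "\<And>x. (u1 has_real_derivative force a c (u x)) (at x)"
    "u 0 = 0" "\<And>x. u x = 0 \<Longrightarrow> u1 x = 0"
    "\<And>x. u (x + L) = u x"
    "\<And>x. u x = 0 \<Longrightarrow> \<exists>k::int. x = of_int k * L"
    by (rule wave_profile[OF r, folded c_def, unfolded T]) (rule that; assumption)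
  have uL: "u L = 0" using u(5)[of 0] u(3) by simp
  define u3 where "u3 = (\<lambda>x. ((u x)\<^sup>2 - a) * u1 x)"
  have d3: "((\<lambda>x. force a c (u x)) has_real_derivative u3 x) (at x)" for x
    unfolding force_def u3_def by (auto intro!: derivative_eq_intros u simp: field_simps)
  have "continuous_on {0..L} u"
    by (rule DERIV_continuous_on[OF has_field_derivative_at_within[OF u(1)]])
  moreover have "continuous_on {0..L} u1"
    by (rule DERIV_continuous_on[OF has_field_derivative_at_within[OF u(2)]])
  ultimately have cont3: "continuous_on {0..L} u3"
    unfolding u3_def by (intro continuous_intros)
  have "C3_on_with L u u1 (\<lambda>x. force a c (u x)) u3"
    unfolding C3_on_with_def
    by (intro conjI ballI cont3 has_field_derivative_at_within[OF u(1)]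
        has_field_derivative_at_within[OF u(2)] has_field_derivative_at_within[OF d3])
  then have sol: "is_solution a L u"
    unfolding is_solution_def using u(3) uL u(4)[OF uL]
    by (intro exI[of _ u1] exI[of _ u3] exI[of _ "\<lambda>x. force a c (u x)"])
      (auto simp: u3_def algebra_simps)
  have "u (L / 2) \<noteq> 0"
  proof
    assume "u (L / 2) = 0"
    then obtain k :: int where "L / 2 = of_int k * L" using u(6) by blast
    then have "of_int (2 * k) = (of_int 1 :: real)" using L by simp
    then have "2 * k = 1" by (simp only: of_int_eq_iff)
    then show False by presburger
  qed
  then have nt: "nontrivial_on L u" unfolding nontrivial_on_def using L by force
  have ext: "periodic_extension L u = u" by (rule periodic_extension_eq[where U = u, OF L u(5) refl])
  have "L \<le> S" if S: "is_period u S" for S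
  proof -
    have S0: "0 < S" and "u S = 0" using S u(3) by (auto simp: is_period_def) (metis add_0)
    then obtain k :: int where k: "S = of_int k * L" using u(6) by blast
    then have "1 \<le> k" using S0 L by (simp add: zero_less_mult_iff)
    then have "1 * L \<le> of_int k * L" using L by (intro mult_right_mono) auto
    then show ?thesis by (simp add: k)
  qed
  then have "is_fundamental_period (periodic_extension L u) L"
    unfolding ext is_fundamental_period_def using L u(5) by (simp add: is_period_def)
  then show ?thesis
    using sol nt unfolding is_nontrivial_solution_with_fundamental_period_L_def by blast
qed

lemma solution_uminus:
  assumes "is_nontrivial_solution_with_fundamental_period_L a L u"
  shows "is_nontrivial_solution_with_fundamental_period_L a L (\<lambda>x. - u x)"
proof -
  obtain u1 u2 u3 where u: "C3_on_with L u u1 u2 u3"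
    "\<forall>x\<in>{0..L}. u3 x + a * u1 x - (u x)\<^sup>2 * u1 x = 0" "u 0 = 0" "u L = 0" "u1 L = 0"
    using assms unfolding is_nontrivial_solution_with_fundamental_period_L_def is_solution_def by blast
  have "C3_on_with L (\<lambda>x. - u x) (\<lambda>x. - u1 x) (\<lambda>x. - u2 x) (\<lambda>x. - u3 x)"
    using u(1) by (auto simp: C3_on_with_def intro!: DERIV_minus continuous_on_minus)
  moreover have "\<forall>x\<in>{0..L}. - u3 x + a * - u1 x - (- u x)\<^sup>2 * - u1 x = 0"
    using u(2) by (auto simp: algebra_simps)
  ultimately have "is_solution a L (\<lambda>x. - u x)"
    unfolding is_solution_def using u(3-5)
    by (intro exI[of _ "\<lambda>x. - u1 x"] exI[of _ "\<lambda>x. - u2 x"] exI[of _ "\<lambda>x. - u3 x"]) simp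
  moreover have "is_fundamental_period (periodic_extension L (\<lambda>x. - u x)) L"
    using assms
    by (simp add: is_nontrivial_solution_with_fundamental_period_L_def is_fundamental_period_def
        is_period_def periodic_extension_def)
  ultimately show ?thesis
    using assms by (simp add: is_nontrivial_solution_with_fundamental_period_L_def nontrivial_on_def)
qed

lemma solution_cong:
  assumes L: "0 < L" and u: "is_nontrivial_solution_with_fundamental_period_L a L u"
    and eq: "\<And>x. x \<in> {0..L} \<Longrightarrow> v x = u x"
  shows "is_nontrivial_solution_with_fundamental_period_L a L v"
proof -
  obtain u1 u2 u3 where *: "C3_on_with L u u1 u2 u3"
    "\<forall>x\<in>{0..L}. u3 x + a * u1 x - (u x)\<^sup>2 * u1 x = 0" "u 0 = 0" "u L = 0" "u1 L = 0"
    using u unfolding is_nontrivial_solution_with_fundamental_period_L_def is_solution_def by blast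
  have "(v has_real_derivative u1 x) (at x within {0..L})" if x: "x \<in> {0..L}" for x
    by (rule has_field_derivative_transform_within[OF _ zero_less_one x])
      (use x eq *(1) in \<open>auto simp: C3_on_with_def\<close>)
  then have "C3_on_with L v u1 u2 u3" using *(1) by (simp add: C3_on_with_def)
  then have "is_solution a L v" unfolding is_solution_def using *(2-5) L
    by (intro exI[of _ u1] exI[of _ u2] exI[of _ u3]) (simp add: eq)
  moreover have "nontrivial_on L v"
    using u by (simp add: is_nontrivial_solution_with_fundamental_period_L_def nontrivial_on_def eq)
  moreover have "periodic_extension L v = periodic_extension L u"
  proof (rule periodic_extension_eq[OF L])
    have "is_period (periodic_extension L u) L"
      using u by (simp add: is_nontrivial_solution_with_fundamental_period_L_def is_fundamental_period_def)
    then show "periodic_extension L u (x + L) = periodic_extension L u x" for x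
      by (simp add: is_period_def)
    fix x assume x: "x \<in> {0..L}"
    have "periodic_extension L u x = u x"
    proof (cases "x = L")
      case True
      then show ?thesis using L *(3,4) by (simp add: periodic_extension_def)
    next
      case False
      then have "\<lfloor>x / L\<rfloor> = 0" using x L by (simp add: floor_eq_iff)
      then show ?thesis by (simp add: periodic_extension_def)
    qed
    then show "v x = periodic_extension L u x" using eq[OF x] by simp
  qed
  ultimately show ?thesis
    using u by (simp add: is_nontrivial_solution_with_fundamental_period_L_def)
qed

lemma less_period_iff:
  assumes "0 < a" "0 < L"
  shows "2 * pi / sqrt a < L \<longleftrightarrow> 4 * pi\<^sup>2 < a * L\<^sup>2"
proof -
  have "2 * pi / sqrt a < L \<longleftrightarrow> 2 * pi < sqrt a * L" using assms by (simp add: field_simps)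
  also have "\<dots> \<longleftrightarrow> (2 * pi)\<^sup>2 < (sqrt a * L)\<^sup>2"
    using assms power_mono_iff[of "sqrt a * L" "2 * pi" 2]
    by (simp add: not_le[symmetric] del: power_mono_iff)
  finally show ?thesis using assms by (simp add: power_mult_distrib)
qed

section \<open>The threshold for solutions with fundamental period \<open>L\<close>\<close>

theorem theorem3:
  fixes a L :: real
  assumes "L > 0"
  shows "(a * L\<^sup>2 > 4 * pi\<^sup>2 \<longrightarrow>
            (\<exists>u. is_nontrivial_solution_with_fundamental_period_L a L u \<and>
               (\<forall>v. is_nontrivial_solution_with_fundamental_period_L a L v \<longleftrightarrow>
                  (\<forall>x\<in>{0..L}. v x = u x) \<or> (\<forall>x\<in>{0..L}. v x = - u x)))) \<and>
         (a * L\<^sup>2 \<le> 4 * pi\<^sup>2 \<longrightarrow>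
            \<not> (\<exists>u. is_nontrivial_solution_with_fundamental_period_L a L u))"
proof -
  let ?P = "is_nontrivial_solution_with_fundamental_period_L a L"
  have sign: "(\<exists>x\<in>{0..L}. 0 < v x) \<or> (\<exists>x\<in>{0..L}. 0 < - v x)" if "?P v" for v
  proof -
    have "\<exists>x\<in>{0..L}. v x \<noteq> 0"
      using that by (simp add: is_nontrivial_solution_with_fundamental_period_L_def nontrivial_on_def)
    then show ?thesis by (metis linorder_neqE_linordered_idom neg_0_less_iff_less)
  qed
  \<comment> \<open>Equal periods force equal maxima, and these fix the Cauchy problem at \<open>0\<close>.\<close>
  have unique: "v y = w y"
    if v: "?P v" "x \<in> {0..L}" "0 < v x" and w: "?P w" "x' \<in> {0..L}" "0 < w x'" and y: "y \<in> {0..L}"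
    for v w x x' y
  proof -
    obtain r v1 where r: "0 < r" "r\<^sup>2 < 2 * a" "wave_period a r = L"
      and dv: "\<And>x. x \<in> {0..L} \<Longrightarrow> (v has_real_derivative v1 x) (at x within {0..L})"
        "\<And>x. x \<in> {0..L} \<Longrightarrow>
          (v1 has_real_derivative force a (r * a / 2 - r^3 / 12) (v x)) (at x within {0..L})"
      and v0: "v 0 = 0" "v1 0 = 0"
      using positive_solution_period[OF assms v] by blast
    obtain r' w1 where r': "0 < r'" "r'\<^sup>2 < 2 * a" "wave_period a r' = L"
      and dw: "\<And>x. x \<in> {0..L} \<Longrightarrow> (w has_real_derivative w1 x) (at x within {0..L})"
        "\<And>x. x \<in> {0..L} \<Longrightarrow>
          (w1 has_real_derivative force a (r' * a / 2 - r'^3 / 12) (w x)) (at x within {0..L})"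
      and w0: "w 0 = 0" "w1 0 = 0"
      using positive_solution_period[OF assms w] by blast
    have "r = r'"
      using wave_period_strict_mono[of r r' a] wave_period_strict_mono[of r' r a] r r'
      by (cases r r' rule: linorder_cases) auto
    show ?thesis
      by (rule profile_equation_unique[where v = v and w = w, OF dv dw[folded \<open>r = r'\<close>], of 0])
        (use v0 w0 y assms in auto)
  qed
  have threshold: "4 * pi\<^sup>2 < a * L\<^sup>2" if v: "?P v" for v
  proof -
    obtain w x where w: "?P w" "x \<in> {0..L}" "0 < w x"
      using sign[OF v] v solution_uminus[OF v] by blast
    obtain r where r: "0 < r" "r\<^sup>2 < 2 * a" "wave_period a r = L"
      by (rule positive_solution_period[OF assms w]) (rule that)
    have "0 < a" using r(2) zero_le_power2[of r] by linarith
    moreover have "2 * pi / sqrt a < L"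
      using wave_period_strict_mono[of 0 r a] r by (simp add: wave_period_zero)
    ultimately show ?thesis using less_period_iff[of a L] assms by simp
  qed
  have existence: "\<exists>u. ?P u \<and> (\<forall>v. ?P v \<longleftrightarrow> (\<forall>x\<in>{0..L}. v x = u x) \<or> (\<forall>x\<in>{0..L}. v x = - u x))"
    if aL: "4 * pi\<^sup>2 < a * L\<^sup>2"
  proof -
    have "0 < a * L\<^sup>2" using aL zero_le_power2[of pi] by linarith
    then have a: "0 < a" using assms by (simp add: zero_less_mult_iff)
    have "2 * pi / sqrt a < L" using less_period_iff[OF a assms] aL by simp
    from wave_period_attained[OF a this] obtain r
      where r: "0 < r" "r\<^sup>2 < 2 * a" "wave_period a r = L" .
    from wave_solution[OF assms r] obtain u0 where u0: "?P u0" ..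
    then obtain u x where u: "?P u" "x \<in> {0..L}" "0 < u x"
      using sign[OF u0] u0 solution_uminus[OF u0] by blast
    have only: "\<forall>v. ?P v \<longleftrightarrow> (\<forall>x\<in>{0..L}. v x = u x) \<or> (\<forall>x\<in>{0..L}. v x = - u x)"
    proof (intro allI iffI)
      fix v assume v: "?P v"
      from sign[OF v] show "(\<forall>x\<in>{0..L}. v x = u x) \<or> (\<forall>x\<in>{0..L}. v x = - u x)"
      proof (elim disjE bexE)
        fix z assume "z \<in> {0..L}" "0 < v z"
        then have "\<forall>y\<in>{0..L}. v y = u y" using unique[OF v _ _ u, of z] by simp
        then show ?thesis ..
      next
        fix z assume "z \<in> {0..L}" "0 < - v z"
        then have "\<forall>y\<in>{0..L}. - v y = u y"
          using unique[OF solution_uminus[OF v] _ _ u, of z] by simp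
        then show ?thesis by force
      qed
    next
      fix v assume "(\<forall>x\<in>{0..L}. v x = u x) \<or> (\<forall>x\<in>{0..L}. v x = - u x)"
      then show "?P v"
      proof
        assume "\<forall>x\<in>{0..L}. v x = u x"
        then show ?thesis by (intro solution_cong[OF assms u(1)]) simp
      next
        assume "\<forall>x\<in>{0..L}. v x = - u x"
        then show ?thesis by (intro solution_cong[OF assms solution_uminus[OF u(1)]]) simp
      qed
    qed
    show ?thesis by (rule exI[of _ u], rule conjI, rule u(1), rule only)
  qed
  show ?thesis
  proof (intro conjI impI)
    assume "4 * pi\<^sup>2 < a * L\<^sup>2"
    then show "\<exists>u. ?P u \<and> (\<forall>v. ?P v \<longleftrightarrow> (\<forall>x\<in>{0..L}. v x = u x) \<or> (\<forall>x\<in>{0..L}. v x = - u x))"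
      by (rule existence)
  next
    assume "a * L\<^sup>2 \<le> 4 * pi\<^sup>2"
    then show "\<not> (\<exists>u. ?P u)" using threshold by (auto simp flip: not_less)
  qed
qed

end
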